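(* Let the WCT operator $T=M_wEM_u$ be bounded on the Orlicz space $L^\Phi(\Sigma)$. Then for every $n\in\mathbb{N}$, $\mathcal{N}(T^2)=\mathcal{N}(T^{n+2})$. As a result, the ascent of $T$ satisfies $\alpha(T)\le 2$.
   Context: $(X,\Sigma,\mu)$ is a complete $\sigma$-finite measure space; functions are complex-valued, identified when equal $\mu$-a.e. A Young function is a convex even function $\Phi:\mathbb{R}\to[0,\infty]$ with $\Phi(0)=0$, neither identically $0$ nor identically $\infty$ on $(0,\infty)$, and left-continuous at $b_\Phi=\sup\{x>0:\Phi(x)<\infty\}$. For a measurable function $f$, $\Phi(f)$ means $\Phi(|f|)$. $\Phi$ is a Young function and $L^\Phi(\mu)=L^\Phi(\Sigma)=\{f \text{ measurable}: \exists k>0,\ \int_X\Phi(kf)\,d\mu<\infty\}$ is the Orlicz space, a Banach space with norm $N_\Phi(f)=\inf\{k>0:\int_X\Phi(f/k)\,d\mu\le1\}$. $\mathcal{A}\subseteq\Sigma$ is a sub-$\sigma$-algebra such that $\mu|_{\mathcal A}$ is $\sigma$-finite, and $E=E^{\mathcal A}$ is the conditional expectation: $E(f)$ is the unique $\mathcal A$-measurable function with $\int_A f\,d\mu=\int_A E(f)\,d\mu$ for $A\in\mathcal A$, defined for $f\ge0$ and extended by linearity to measurable $f$ with $E(|f|)<\infty$ a.e. For measurable $u,w:X\to\mathbb{C}$, the WCT (weighted conditional type) operator $T=M_wEM_u$ is $T(f)=wE(uf)$, where it is understood that $E(uw)$ and $E(uf)$, $f\in L^\Phi(\mu)$, are defined.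 $\mathcal{N}(S)$ denotes the null space of $S$. The ascent $\alpha(S)$ is the smallest non-negative integer $k$ with $\mathcal{N}(S^k)=\mathcal{N}(S^{k+1})$ ($\infty$ if there is none). $\mathbb{N}=\{1,2,\dots\}$. *)

theory Defs
  imports "HOL-Probability.Probability" "HOL-Library.Extended_Nat"
begin

text \<open>
  Functions that agree almost everywhere are to be identified.  Throughout, elements of the
  Orlicz space are represented by measurable functions, operators act on representatives, and
  being zero (as in the definition of null spaces) means being zero almost everywhere.  The lemma
  \<open>wct_op_cong_AE\<close> shows that the operator under consideration respects this identification.
\<close>

definition young_bound :: "(real \<Rightarrow> ennreal) \<Rightarrow> ereal" where
  "young_bound \<Phi> = Sup {ereal x | x. 0 < x \<and> \<Phi> x < \<infinity>}"

text \<open>If the bound is infinite, left-continuity there is no restriction on a function on the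
  real line.\<close>

definition young_function :: "(real \<Rightarrow> ennreal) \<Rightarrow> bool" where
  "young_function \<Phi> \<longleftrightarrow>
     (\<forall>x y a b. 0 \<le> a \<longrightarrow> 0 \<le> b \<longrightarrow> a + b = 1 \<longrightarrow>
        \<Phi> (a * x + b * y) \<le> ennreal a * \<Phi> x + ennreal b * \<Phi> y) \<and>
     (\<forall>x. \<Phi> (- x) = \<Phi> x) \<and>
     \<Phi> 0 = 0 \<and>
     (\<exists>x>0. \<Phi> x \<noteq> 0) \<and>
     (\<exists>x>0. \<Phi> x \<noteq> \<infinity>) \<and>
     (\<forall>b. young_bound \<Phi> = ereal b \<longrightarrow> continuous (at_left b) \<Phi>)"

definition orlicz_space :: "'a measure \<Rightarrow> (real \<Rightarrow> ennreal) \<Rightarrow> ('a \<Rightarrow> complex) set" where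
  "orlicz_space M \<Phi> =
     {f \<in> borel_measurable M.
        \<exists>k>0. (\<integral>\<^sup>+ x. \<Phi> (norm (complex_of_real k * f x)) \<partial>M) < \<infinity>}"

definition orlicz_norm :: "'a measure \<Rightarrow> (real \<Rightarrow> ennreal) \<Rightarrow> ('a \<Rightarrow> complex) \<Rightarrow> real" where
  "orlicz_norm M \<Phi> f =
     Inf {k. 0 < k \<and> (\<integral>\<^sup>+ x. \<Phi> (norm (f x / complex_of_real k)) \<partial>M) \<le> 1}"

definition orlicz_bounded ::
  "'a measure \<Rightarrow> (real \<Rightarrow> ennreal) \<Rightarrow> (('a \<Rightarrow> complex) \<Rightarrow> ('a \<Rightarrow> complex)) \<Rightarrow> bool" where
  "orlicz_bounded M \<Phi> S \<longleftrightarrow>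
     (\<forall>f \<in> orlicz_space M \<Phi>. S f \<in> orlicz_space M \<Phi>) \<and>
     (\<exists>C\<ge>0. \<forall>f \<in> orlicz_space M \<Phi>. orlicz_norm M \<Phi> (S f) \<le> C * orlicz_norm M \<Phi> f)"

text \<open>The conditional expectation of a complex function is meaningful when the one of its modulus,
  which always exists as an extended nonnegative function, is finite almost everywhere;
  integrability is not required.  Under this condition the library's \<^const>\<open>real_cond_exp\<close>, being
  the difference of the conditional expectations of positive and negative part, is the extension
  by linearity for real functions.\<close>

definition cond_exp_defined :: "'a measure \<Rightarrow> 'a measure \<Rightarrow> ('a \<Rightarrow> complex) \<Rightarrow> bool" where
  "cond_exp_defined M F f \<longleftrightarrow>
     f \<in> borel_measurable M \<and>
     (AE x in M. nn_cond_exp M F (\<lambda>y. ennreal (norm (f y))) x < \<infinity>)"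

definition complex_cond_exp ::
  "'a measure \<Rightarrow> 'a measure \<Rightarrow> ('a \<Rightarrow> complex) \<Rightarrow> ('a \<Rightarrow> complex)" where
  "complex_cond_exp M F f =
     (\<lambda>x. Complex (real_cond_exp M F (\<lambda>y. Re (f y)) x) (real_cond_exp M F (\<lambda>y. Im (f y)) x))"

definition wct_op ::
  "'a measure \<Rightarrow> 'a measure \<Rightarrow> ('a \<Rightarrow> complex) \<Rightarrow> ('a \<Rightarrow> complex) \<Rightarrow>
     ('a \<Rightarrow> complex) \<Rightarrow> ('a \<Rightarrow> complex)" where
  "wct_op M F w u f = (\<lambda>x. w x * complex_cond_exp M F (\<lambda>y. u y * f y) x)"

lemma wct_op_cong_AE:
  assumes F: "sigma_finite_subalgebra M F"
    and [measurable]: "u \<in> borel_measurable M" "f \<in> borel_measurable M" "g \<in> borel_measurable M"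
    and fg: "AE x in M. f x = g x"
  shows "AE x in M. wct_op M F w u f x = wct_op M F w u g x"
proof -
  interpret sigma_finite_subalgebra M F by (fact F)
  have "AE x in M. real_cond_exp M F (\<lambda>y. Re (u y * f y)) x =
                   real_cond_exp M F (\<lambda>y. Re (u y * g y)) x"
    by (rule real_cond_exp_cong) (use fg in \<open>auto simp del: times_complex.simps\<close>)
  moreover have "AE x in M. real_cond_exp M F (\<lambda>y. Im (u y * f y)) x =
                   real_cond_exp M F (\<lambda>y. Im (u y * g y)) x"
    by (rule real_cond_exp_cong) (use fg in \<open>auto simp del: times_complex.simps\<close>)
  ultimately show ?thesis
    unfolding wct_op_def complex_cond_exp_def by eventually_elim (simp only:)
qed

definition orlicz_null_space ::
  "'a measure \<Rightarrow> (real \<Rightarrow> ennreal) \<Rightarrow> (('a \<Rightarrow> complex) \<Rightarrow> ('a \<Rightarrow> complex)) \<Rightarrow>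
     ('a \<Rightarrow> complex) set" where
  "orlicz_null_space M \<Phi> S = {f \<in> orlicz_space M \<Phi>. AE x in M. S f x = 0}"

definition ascent ::
  "'a measure \<Rightarrow> (real \<Rightarrow> ennreal) \<Rightarrow> (('a \<Rightarrow> complex) \<Rightarrow> ('a \<Rightarrow> complex)) \<Rightarrow> enat" where
  "ascent M \<Phi> S =
     (if \<exists>k. orlicz_null_space M \<Phi> (S ^^ k) = orlicz_null_space M \<Phi> (S ^^ Suc k)
      then enat (LEAST k. orlicz_null_space M \<Phi> (S ^^ k) = orlicz_null_space M \<Phi> (S ^^ Suc k))
      else \<infinity>)"

end

theory Submission
  imports Defs
begin

text \<open>
  The theorem rests on one formula.  Put \<open>a = E(uw)\<close> and \<open>g = E(uf)\<close>.  Both are measurable with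
  respect to the sub-\<open>\<sigma>\<close>-algebra and so move through \<open>E\<close> like scalars.  From \<open>T f = w g\<close> it follows
  that \<open>T (w a\<^sup>n g) = w E(uw a\<^sup>n g) = w a\<^sup>n\<^sup>+\<^sup>1 g\<close>, hence \<open>T\<^sup>n\<^sup>+\<^sup>1 f = w a\<^sup>n g\<close> almost everywhere.  Thus
  \<open>T\<^sup>n\<^sup>+\<^sup>2 f = w a\<^sup>n\<^sup>+\<^sup>1 g\<close> has, up to a null set, the same zeros as \<open>T\<^sup>2 f = w a g\<close>: once \<open>a\<close> occurs as a
  factor, raising it to a higher power creates no new zeros.

  The analytic content is that factors measurable with respect to the sub-\<open>\<sigma>\<close>-algebra can be pulled
  out of \<open>E\<close> without integrability: \<open>uw\<close> is merely known to satisfy \<open>E(|uw|) < \<infinity>\<close> almost everywhere.  The rule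
  is obtained from the one for extended nonnegative functions, which is unconditional, by
  splitting into positive and negative parts; finiteness makes the resulting subtractions
  legitimate (lemmas \<open>real_cond_exp_eq_diff\<close> and \<open>complex_cond_exp_mult\<close>).
\<close>

section \<open>Pulling out factors without integrability\<close>

context sigma_finite_subalgebra
begin

text \<open>Conditional expectations may be computed from any decomposition of a function into a
  difference of nonnegative functions with finite conditional expectations, not only from the one
  into positive and negative part.  Additivity and the pull-out rule both follow from this.\<close>

lemma real_cond_exp_eq_diff:
  fixes f p q :: "'a \<Rightarrow> real"
  assumes [measurable]: "f \<in> borel_measurable M" "p \<in> borel_measurable M" "q \<in> borel_measurable M"
    and nonneg: "\<And>x. 0 \<le> p x" "\<And>x. 0 \<le> q x"
    and f: "\<And>x. f x = p x - q x"
    and fin: "AE x in M. nn_cond_exp M F (\<lambda>y. ennreal (p y)) x < \<infinity>"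
      "AE x in M. nn_cond_exp M F (\<lambda>y. ennreal (q y)) x < \<infinity>"
  shows "AE x in M. real_cond_exp M F f x =
    enn2real (nn_cond_exp M F (\<lambda>y. ennreal (p y)) x)
    - enn2real (nn_cond_exp M F (\<lambda>y. ennreal (q y)) x)"
proof -
  \<comment> \<open>Comparing \<open>f = f\<^sup>+ - f\<^sup>-\<close> with \<open>f = p - q\<close> in the subtraction-free form
    \<open>f\<^sup>+ + q = f\<^sup>- + p\<close>, to which additivity of extended nonnegative functions applies.\<close>
  have "(\<lambda>y. ennreal (f y) + ennreal (q y)) = (\<lambda>y. ennreal (- f y) + ennreal (p y))"
  proof
    fix y
    have "max 0 (f y) + q y = max 0 (- f y) + p y"
      using f[of y] by auto
    then have "ennreal (max 0 (f y) + q y) = ennreal (max 0 (- f y) + p y)"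
      by simp
    then show "ennreal (f y) + ennreal (q y) = ennreal (- f y) + ennreal (p y)"
      using nonneg[of y] by (simp add: ennreal_plus ennreal_max_0)
  qed
  then have "AE x in M.
      nn_cond_exp M F (\<lambda>y. ennreal (f y)) x + nn_cond_exp M F (\<lambda>y. ennreal (q y)) x =
      nn_cond_exp M F (\<lambda>y. ennreal (- f y)) x + nn_cond_exp M F (\<lambda>y. ennreal (p y)) x"
    using nn_cond_exp_sum[of "\<lambda>y. ennreal (f y)" "\<lambda>y. ennreal (q y)"]
      nn_cond_exp_sum[of "\<lambda>y. ennreal (- f y)" "\<lambda>y. ennreal (p y)"]
    by auto
  moreover have "AE x in M. nn_cond_exp M F (\<lambda>y. ennreal (f y)) x \<le>
      nn_cond_exp M F (\<lambda>y. ennreal (p y)) x"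
    by (rule nn_cond_exp_mono) (use nonneg f in \<open>auto intro!: ennreal_leI\<close>)
  moreover have "AE x in M. nn_cond_exp M F (\<lambda>y. ennreal (- f y)) x \<le>
      nn_cond_exp M F (\<lambda>y. ennreal (q y)) x"
    by (rule nn_cond_exp_mono) (use nonneg f in \<open>auto intro!: ennreal_leI\<close>)
  ultimately show ?thesis
    using fin
  proof eventually_elim
    case (elim x)
    have fin': "nn_cond_exp M F (\<lambda>y. ennreal (f y)) x < \<infinity>"
      "nn_cond_exp M F (\<lambda>y. ennreal (- f y)) x < \<infinity>"
      using elim by (auto intro: le_less_trans)
    have "enn2real (nn_cond_exp M F (\<lambda>y. ennreal (f y)) x)
        + enn2real (nn_cond_exp M F (\<lambda>y. ennreal (q y)) x) =
      enn2real (nn_cond_exp M F (\<lambda>y. ennreal (- f y)) x)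
        + enn2real (nn_cond_exp M F (\<lambda>y. ennreal (p y)) x)"
      using elim fin' by (simp flip: enn2real_plus)
    then show ?case
      by (simp add: real_cond_exp_def)
  qed
qed

lemma nn_cond_exp_linear_combination:
  fixes a b f h :: "'a \<Rightarrow> ennreal"
  assumes ab [measurable]: "a \<in> borel_measurable F" "b \<in> borel_measurable F"
    and [measurable]: "f \<in> borel_measurable M" "h \<in> borel_measurable M"
  shows "AE x in M. nn_cond_exp M F (\<lambda>y. a y * f y + b y * h y) x =
    a x * nn_cond_exp M F f x + b x * nn_cond_exp M F h x"
proof -
  have [measurable]: "a \<in> borel_measurable M" "b \<in> borel_measurable M"
    using ab by (auto intro: measurable_from_subalg[OF subalg])
  show ?thesis
    using nn_cond_exp_sum[of "\<lambda>y. a y * f y" "\<lambda>y. b y * h y"]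
      nn_cond_exp_prod[of a f] nn_cond_exp_prod[of b h]
    by auto
qed

lemma nn_cond_exp_finite_pos_neg_parts:
  fixes f :: "'a \<Rightarrow> real"
  assumes [measurable]: "f \<in> borel_measurable M"
    and fin: "AE x in M. nn_cond_exp M F (\<lambda>y. ennreal \<bar>f y\<bar>) x < \<infinity>"
  shows "AE x in M. nn_cond_exp M F (\<lambda>y. ennreal (f y)) x < \<infinity> \<and>
    nn_cond_exp M F (\<lambda>y. ennreal (- f y)) x < \<infinity>"
proof -
  have "AE x in M. nn_cond_exp M F (\<lambda>y. ennreal (f y)) x \<le>
      nn_cond_exp M F (\<lambda>y. ennreal \<bar>f y\<bar>) x"
    by (rule nn_cond_exp_mono) (auto intro!: ennreal_leI)
  moreover have "AE x in M. nn_cond_exp M F (\<lambda>y. ennreal (- f y)) x \<le>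
      nn_cond_exp M F (\<lambda>y. ennreal \<bar>f y\<bar>) x"
    by (rule nn_cond_exp_mono) (auto intro!: ennreal_leI)
  ultimately show ?thesis
    using fin by eventually_elim (auto intro: le_less_trans)
qed

lemma nn_cond_exp_abs_mult_finite:
  fixes f g :: "'a \<Rightarrow> real"
  assumes [measurable]: "g \<in> borel_measurable F" "f \<in> borel_measurable M"
    and fin: "AE x in M. nn_cond_exp M F (\<lambda>y. ennreal \<bar>f y\<bar>) x < \<infinity>"
  shows "AE x in M. nn_cond_exp M F (\<lambda>y. ennreal \<bar>g y * f y\<bar>) x < \<infinity>"
proof -
  have "AE x in M. ennreal \<bar>g x\<bar> * nn_cond_exp M F (\<lambda>y. ennreal \<bar>f y\<bar>) x =
      nn_cond_exp M F (\<lambda>y. ennreal \<bar>g y\<bar> * ennreal \<bar>f y\<bar>) x"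
    by (rule nn_cond_exp_prod) auto
  then show ?thesis
    using fin
  proof eventually_elim
    case (elim x)
    have "ennreal \<bar>g x\<bar> * nn_cond_exp M F (\<lambda>y. ennreal \<bar>f y\<bar>) x < \<infinity>"
      using elim(2) by (simp add: ennreal_mult_less_top)
    then show ?case
      using elim(1) by (simp add: abs_mult ennreal_mult)
  qed
qed

text \<open>This rule and the next two replace integrability by finiteness of the conditional
  expectation of the modulus.\<close>

lemma real_cond_exp_add_finite:
  fixes f h :: "'a \<Rightarrow> real"
  assumes [measurable]: "f \<in> borel_measurable M" "h \<in> borel_measurable M"
    and fin: "AE x in M. nn_cond_exp M F (\<lambda>y. ennreal \<bar>f y\<bar>) x < \<infinity>"
      "AE x in M. nn_cond_exp M F (\<lambda>y. ennreal \<bar>h y\<bar>) x < \<infinity>"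
  shows "AE x in M. real_cond_exp M F (\<lambda>y. f y + h y) x =
    real_cond_exp M F f x + real_cond_exp M F h x"
proof -
  have f_parts: "AE x in M. nn_cond_exp M F (\<lambda>y. ennreal (f y)) x < \<infinity> \<and>
      nn_cond_exp M F (\<lambda>y. ennreal (- f y)) x < \<infinity>"
    using fin by (intro nn_cond_exp_finite_pos_neg_parts) auto
  have h_parts: "AE x in M. nn_cond_exp M F (\<lambda>y. ennreal (h y)) x < \<infinity> \<and>
      nn_cond_exp M F (\<lambda>y. ennreal (- h y)) x < \<infinity>"
    using fin by (intro nn_cond_exp_finite_pos_neg_parts) auto
  define p where "p = (\<lambda>y. max 0 (f y) + max 0 (h y))"
  define q where "q = (\<lambda>y. max 0 (- f y) + max 0 (- h y))"
  have [measurable]: "p \<in> borel_measurable M" "q \<in> borel_measurable M"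
    by (simp_all add: p_def q_def)
  have Ep: "AE x in M. nn_cond_exp M F (\<lambda>y. ennreal (p y)) x =
      nn_cond_exp M F (\<lambda>y. ennreal (f y)) x + nn_cond_exp M F (\<lambda>y. ennreal (h y)) x"
    using nn_cond_exp_sum[of "\<lambda>y. ennreal (f y)" "\<lambda>y. ennreal (h y)"]
    by (auto simp: p_def)
  have Eq: "AE x in M. nn_cond_exp M F (\<lambda>y. ennreal (q y)) x =
      nn_cond_exp M F (\<lambda>y. ennreal (- f y)) x + nn_cond_exp M F (\<lambda>y. ennreal (- h y)) x"
    using nn_cond_exp_sum[of "\<lambda>y. ennreal (- f y)" "\<lambda>y. ennreal (- h y)"]
    by (auto simp: q_def)
  have "AE x in M. real_cond_exp M F (\<lambda>y. f y + h y) x =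
      enn2real (nn_cond_exp M F (\<lambda>y. ennreal (p y)) x)
      - enn2real (nn_cond_exp M F (\<lambda>y. ennreal (q y)) x)"
  proof (rule real_cond_exp_eq_diff)
    show "AE x in M. nn_cond_exp M F (\<lambda>y. ennreal (p y)) x < \<infinity>"
      using Ep f_parts h_parts by eventually_elim simp
    show "AE x in M. nn_cond_exp M F (\<lambda>y. ennreal (q y)) x < \<infinity>"
      using Eq f_parts h_parts by eventually_elim simp
  qed (auto simp: p_def q_def)
  then show ?thesis
    using Ep Eq f_parts h_parts by eventually_elim (simp add: real_cond_exp_def enn2real_plus)
qed

lemma real_cond_exp_mult_finite:
  fixes f g :: "'a \<Rightarrow> real"
  assumes g [measurable]: "g \<in> borel_measurable F" and [measurable]: "f \<in> borel_measurable M"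
    and fin: "AE x in M. nn_cond_exp M F (\<lambda>y. ennreal \<bar>f y\<bar>) x < \<infinity>"
  shows "AE x in M. real_cond_exp M F (\<lambda>y. g y * f y) x = g x * real_cond_exp M F f x"
proof -
  have [measurable]: "g \<in> borel_measurable M"
    using g by (rule measurable_from_subalg[OF subalg])
  have parts: "AE x in M. nn_cond_exp M F (\<lambda>y. ennreal (f y)) x < \<infinity> \<and>
      nn_cond_exp M F (\<lambda>y. ennreal (- f y)) x < \<infinity>"
    using fin by (intro nn_cond_exp_finite_pos_neg_parts) auto
  define p where "p = (\<lambda>y. max 0 (g y) * max 0 (f y) + max 0 (- g y) * max 0 (- f y))"
  define q where "q = (\<lambda>y. max 0 (g y) * max 0 (- f y) + max 0 (- g y) * max 0 (f y))"
  have [measurable]: "p \<in> borel_measurable M" "q \<in> borel_measurable M"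
    by (simp_all add: p_def q_def)
  have p: "ennreal (p y) = ennreal (g y) * ennreal (f y) + ennreal (- g y) * ennreal (- f y)"
    and q: "ennreal (q y) = ennreal (g y) * ennreal (- f y) + ennreal (- g y) * ennreal (f y)" for y
    by (simp_all add: p_def q_def ennreal_plus ennreal_mult)
  have Ep: "AE x in M. nn_cond_exp M F (\<lambda>y. ennreal (p y)) x =
      ennreal (g x) * nn_cond_exp M F (\<lambda>y. ennreal (f y)) x
      + ennreal (- g x) * nn_cond_exp M F (\<lambda>y. ennreal (- f y)) x"
    unfolding p by (rule nn_cond_exp_linear_combination) auto
  have Eq: "AE x in M. nn_cond_exp M F (\<lambda>y. ennreal (q y)) x =
      ennreal (g x) * nn_cond_exp M F (\<lambda>y. ennreal (- f y)) x
      + ennreal (- g x) * nn_cond_exp M F (\<lambda>y. ennreal (f y)) x"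
    unfolding q by (rule nn_cond_exp_linear_combination) auto
  have "AE x in M. real_cond_exp M F (\<lambda>y. g y * f y) x =
      enn2real (nn_cond_exp M F (\<lambda>y. ennreal (p y)) x)
      - enn2real (nn_cond_exp M F (\<lambda>y. ennreal (q y)) x)"
  proof (rule real_cond_exp_eq_diff)
    show "AE x in M. nn_cond_exp M F (\<lambda>y. ennreal (p y)) x < \<infinity>"
      using Ep parts by eventually_elim (simp add: ennreal_mult_less_top)
    show "AE x in M. nn_cond_exp M F (\<lambda>y. ennreal (q y)) x < \<infinity>"
      using Eq parts by eventually_elim (simp add: ennreal_mult_less_top)
  qed (auto simp: p_def q_def max_def)
  then show ?thesis
    using Ep Eq
  proof eventually_elim
    case (elim x)
    \<comment> \<open>At each point one of \<open>g\<^sup>+\<close>, \<open>g\<^sup>-\<close> vanishes, leaving a single product in each sum.\<close>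
    show ?case
      unfolding elim real_cond_exp_def[of M F f]
      by (cases "0 \<le> g x") (simp_all add: ennreal_neg enn2real_mult algebra_simps)
  qed
qed

text \<open>The complex rule reduces to the two real ones because real and imaginary part of a product
  are sums of products of real functions with one factor measurable with respect to \<open>F\<close>.\<close>

lemma complex_cond_exp_mult:
  fixes f g :: "'a \<Rightarrow> complex"
  assumes [measurable]: "g \<in> borel_measurable F" and f: "cond_exp_defined M F f"
  shows "AE x in M. complex_cond_exp M F (\<lambda>y. g y * f y) x = g x * complex_cond_exp M F f x"
proof -
  have [measurable]: "f \<in> borel_measurable M"
    and fin: "AE x in M. nn_cond_exp M F (\<lambda>y. ennreal (norm (f y))) x < \<infinity>"
    using f by (auto simp: cond_exp_defined_def)
  have "AE x in M. nn_cond_exp M F (\<lambda>y. ennreal \<bar>Re (f y)\<bar>) x \<le>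
      nn_cond_exp M F (\<lambda>y. ennreal (norm (f y))) x"
    by (rule nn_cond_exp_mono) (auto intro!: ennreal_leI abs_Re_le_cmod)
  then have Re: "AE x in M. nn_cond_exp M F (\<lambda>y. ennreal \<bar>Re (f y)\<bar>) x < \<infinity>"
    using fin by eventually_elim (rule le_less_trans)
  have "AE x in M. nn_cond_exp M F (\<lambda>y. ennreal \<bar>Im (f y)\<bar>) x \<le>
      nn_cond_exp M F (\<lambda>y. ennreal (norm (f y))) x"
    by (rule nn_cond_exp_mono) (auto intro!: ennreal_leI abs_Im_le_cmod)
  then have Im: "AE x in M. nn_cond_exp M F (\<lambda>y. ennreal \<bar>Im (f y)\<bar>) x < \<infinity>"
    using fin by eventually_elim (rule le_less_trans)
  have combination: "AE x in M. real_cond_exp M F (\<lambda>y. a y * Re (f y) + b y * Im (f y)) x =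
      a x * real_cond_exp M F (\<lambda>y. Re (f y)) x + b x * real_cond_exp M F (\<lambda>y. Im (f y)) x"
    if ab [measurable]: "a \<in> borel_measurable F" "b \<in> borel_measurable F" for a b :: "'a \<Rightarrow> real"
  proof -
    have [measurable]: "a \<in> borel_measurable M" "b \<in> borel_measurable M"
      using ab by (auto intro: measurable_from_subalg[OF subalg])
    have "AE x in M. real_cond_exp M F (\<lambda>y. a y * Re (f y) + b y * Im (f y)) x =
        real_cond_exp M F (\<lambda>y. a y * Re (f y)) x + real_cond_exp M F (\<lambda>y. b y * Im (f y)) x"
      using Re Im by (intro real_cond_exp_add_finite nn_cond_exp_abs_mult_finite) auto
    moreover have "AE x in M. real_cond_exp M F (\<lambda>y. a y * Re (f y)) x =
        a x * real_cond_exp M F (\<lambda>y. Re (f y)) x"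
      using Re by (intro real_cond_exp_mult_finite) auto
    moreover have "AE x in M. real_cond_exp M F (\<lambda>y. b y * Im (f y)) x =
        b x * real_cond_exp M F (\<lambda>y. Im (f y)) x"
      using Im by (intro real_cond_exp_mult_finite) auto
    ultimately show ?thesis
      by eventually_elim simp
  qed
  have "AE x in M. real_cond_exp M F (\<lambda>y. Re (g y * f y)) x =
      Re (g x) * real_cond_exp M F (\<lambda>y. Re (f y)) x
      - Im (g x) * real_cond_exp M F (\<lambda>y. Im (f y)) x"
    using combination[of "\<lambda>y. Re (g y)" "\<lambda>y. - Im (g y)"] by simp
  moreover have "AE x in M. real_cond_exp M F (\<lambda>y. Im (g y * f y)) x =
      Im (g x) * real_cond_exp M F (\<lambda>y. Re (f y)) x
      + Re (g x) * real_cond_exp M F (\<lambda>y. Im (f y)) x"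
    using combination[of "\<lambda>y. Im (g y)" "\<lambda>y. Re (g y)"] by (simp add: add.commute)
  ultimately show ?thesis
    unfolding complex_cond_exp_def
    by eventually_elim (simp add: complex_eq_iff)
qed

lemma complex_cond_exp_measurable [measurable]:
  "complex_cond_exp M F f \<in> borel_measurable F"
proof -
  have "complex_cond_exp M F f =
      (\<lambda>x. complex_of_real (real_cond_exp M F (\<lambda>y. Re (f y)) x)
        + \<i> * complex_of_real (real_cond_exp M F (\<lambda>y. Im (f y)) x))"
    by (simp add: complex_cond_exp_def complex_eq_iff fun_eq_iff)
  then show ?thesis
    by simp
qed

section \<open>Powers of a weighted conditional type operator\<close>

lemma wct_op_measurable:
  assumes "w \<in> borel_measurable M"
  shows "wct_op M F w u f \<in> borel_measurable M"
proof -
  have [measurable]: "complex_cond_exp M F (\<lambda>y. u y * f y) \<in> borel_measurable M"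
    by (rule measurable_from_subalg[OF subalg]) simp
  show ?thesis
    using assms unfolding wct_op_def by measurable
qed

text \<open>The first application of \<open>T\<close> produces \<open>w \<phi>\<close> with \<open>\<phi>\<close> measurable with respect to \<open>F\<close>.  On
  functions of this form \<open>T\<close> acts as multiplication by \<open>E(uw)\<close>, since \<open>E(uw \<phi>) = E(uw) \<phi>\<close>.\<close>

lemma wct_op_funpow_Suc:
  fixes u w f :: "'a \<Rightarrow> complex"
  assumes [measurable]: "u \<in> borel_measurable M" "w \<in> borel_measurable M"
    and uw: "cond_exp_defined M F (\<lambda>x. u x * w x)"
  shows "AE x in M. (wct_op M F w u ^^ Suc n) f x =
    w x * complex_cond_exp M F (\<lambda>y. u y * w y) x ^ n * complex_cond_exp M F (\<lambda>y. u y * f y) x"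
proof (induction n)
  case 0
  show ?case
    by (simp add: wct_op_def)
next
  case (Suc n)
  define a where "a = complex_cond_exp M F (\<lambda>y. u y * w y)"
  define g where "g = complex_cond_exp M F (\<lambda>y. u y * f y)"
  have F [measurable]: "a \<in> borel_measurable F" "g \<in> borel_measurable F"
    by (simp_all add: a_def g_def)
  have [measurable]: "a \<in> borel_measurable M" "g \<in> borel_measurable M"
    using F by (auto intro: measurable_from_subalg[OF subalg])
  have "AE x in M. wct_op M F w u ((wct_op M F w u ^^ Suc n) f) x =
      wct_op M F w u (\<lambda>x. w x * a x ^ n * g x) x"
    using Suc.IH unfolding a_def[symmetric] g_def[symmetric]
    by (intro wct_op_cong_AE[OF sigma_finite_subalgebra_axioms])
      (simp_all add: wct_op_measurable)
  moreover have "AE x in M. wct_op M F w u (\<lambda>x. w x * a x ^ n * g x) x = w x * a x ^ Suc n * g x"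
  proof -
    have "(\<lambda>y. u y * (w y * a y ^ n * g y)) = (\<lambda>y. (a y ^ n * g y) * (u y * w y))"
      by (simp add: ac_simps)
    moreover have "AE x in M. complex_cond_exp M F (\<lambda>y. (a y ^ n * g y) * (u y * w y)) x =
        (a x ^ n * g x) * complex_cond_exp M F (\<lambda>y. u y * w y) x"
      using uw by (intro complex_cond_exp_mult) simp_all
    ultimately show ?thesis
      unfolding wct_op_def a_def[symmetric] by (auto simp only: power_Suc ac_simps)
  qed
  ultimately have "AE x in M. wct_op M F w u ((wct_op M F w u ^^ Suc n) f) x =
      w x * a x ^ Suc n * g x"
    by eventually_elim (rule trans)
  then show ?case
    unfolding a_def g_def funpow.simps(2)[of "Suc n"] comp_apply .
qed

text \<open>The factor \<open>E(uw)\<close> occurs in \<open>T\<^sup>m\<^sup>+\<^sup>2 f\<close> with the positive exponent \<open>m + 1\<close>, so the zero set does not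
  depend on \<open>m\<close>.  For \<open>T f\<close> the exponent is \<open>0\<close>, so points where \<open>E(uw)\<close> vanishes but \<open>w E(uf)\<close>
  does not are zeros of \<open>T\<^sup>2 f\<close> and not of \<open>T f\<close>.\<close>

lemma wct_op_null_space_stabilizes:
  fixes u w :: "'a \<Rightarrow> complex"
  assumes "u \<in> borel_measurable M" "w \<in> borel_measurable M"
    and "cond_exp_defined M F (\<lambda>x. u x * w x)"
  shows "orlicz_null_space M \<Phi> (wct_op M F w u ^^ (n + 2)) =
    orlicz_null_space M \<Phi> (wct_op M F w u ^^ 2)"
proof -
  have zero_iff: "(AE x in M. (wct_op M F w u ^^ (m + 2)) f x = 0) \<longleftrightarrow>
      (AE x in M. w x * complex_cond_exp M F (\<lambda>y. u y * w y) x
        * complex_cond_exp M F (\<lambda>y. u y * f y) x = 0)" for m f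
  proof (rule eventually_cong)
    show "AE x in M. (wct_op M F w u ^^ Suc (Suc m)) f x =
        w x * complex_cond_exp M F (\<lambda>y. u y * w y) x ^ Suc m
          * complex_cond_exp M F (\<lambda>y. u y * f y) x"
      by (rule wct_op_funpow_Suc[OF assms])
  qed auto
  show ?thesis
    by (simp only: orlicz_null_space_def zero_iff[of n] zero_iff[of 0, unfolded add_0])
qed

end

theorem proposition2p4:
  fixes M F :: "'a measure"
    and \<Phi> :: "real \<Rightarrow> ennreal"
    and u w :: "'a \<Rightarrow> complex"
  assumes "sigma_finite_measure M"
    and "complete_measure M"
    and "sigma_finite_subalgebra M F"
    and "young_function \<Phi>"
    and "u \<in> borel_measurable M"
    and "w \<in> borel_measurable M"
    and "cond_exp_defined M F (\<lambda>x. u x * w x)"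
    and "\<forall>f \<in> orlicz_space M \<Phi>. cond_exp_defined M F (\<lambda>x. u x * f x)"
    and "orlicz_bounded M \<Phi> (wct_op M F w u)"
  shows "(\<forall>n\<ge>1. orlicz_null_space M \<Phi> (wct_op M F w u ^^ 2) =
                 orlicz_null_space M \<Phi> (wct_op M F w u ^^ (n + 2))) \<and>
         ascent M \<Phi> (wct_op M F w u) \<le> 2"
proof (intro conjI allI impI)
  interpret sigma_finite_subalgebra M F
    by fact
  note stable = wct_op_null_space_stabilizes[OF assms(5,6,7), of \<Phi>]
  show "orlicz_null_space M \<Phi> (wct_op M F w u ^^ 2) =
      orlicz_null_space M \<Phi> (wct_op M F w u ^^ (n + 2))" for n
    by (rule stable[symmetric])
  have "orlicz_null_space M \<Phi> (wct_op M F w u ^^ 2) =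
      orlicz_null_space M \<Phi> (wct_op M F w u ^^ Suc 2)"
    using stable[of 1] by (simp only: add.commute[of 1] Suc_eq_plus1)
  then show "ascent M \<Phi> (wct_op M F w u) \<le> 2"
    unfolding ascent_def numeral_eq_enat
    by (subst if_P, blast) (auto simp only: enat_ord_simps intro: Least_le)
qed

end
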